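(* Let $J\subsetneq I\subset S=K[x_1,\ldots,x_n]$ be monomial ideals, and let $g$ and the characteristic poset $P^g_{I/J}$ be as in the context. Then $$\operatorname{sdepth} I/J=\max\{\operatorname{sdepth}\mathcal{D}(\mathcal{P}): \mathcal{P}\text{ is a partition of }P^g_{I/J}\}.$$ In particular, there exists a partition $\mathcal{P}:\ P^g_{I/J}=\bigcup_{i=1}^r[c_i,d_i]$ of $P^g_{I/J}$ such that $$\operatorname{sdepth}I/J=\min\{\rho(d_i): i=1,\ldots,r\}.$$
   Context: $K$ is a field and $S=K[x_1,\ldots,x_n]$ with its $\mathbb{Z}^n$-grading. For a finitely generated $\mathbb{Z}^n$-graded $S$-module $M$, a homogeneous $u\in M$ and $Z\subset\{x_1,\ldots,x_n\}$, $uK[Z]$ denotes the $K$-subspace of $M$ generated by all $uv$ with $v$ a monomial in $K[Z]$; it is a Stanley space of dimension $|Z|$ if it is a free $K[Z]$-module. A Stanley decomposition of $M$ is a presentation $\mathcal{D}: M=\bigoplus_{i=1}^m u_iK[Z_i]$ of $M$ as a finite direct sum of Stanley spaces, as $\mathbb{Z}^n$-graded $K$-vector spaces; $\operatorname{sdepth}\mathcal{D}=\min\{|Z_i|\}$, and $\operatorname{sdepth}M$ is the maximum of $\operatorname{sdepth}\mathcal{D}$ over all Stanley decompositions $\mathcal{D}$ of $M$. For $a\in\mathbb{N}^n$ (with $0\in\mathbb{N}$), $x^a=x_1^{a(1)}\cdots x_n^{a(n)}$; $\mathbb{N}^n$ is partially ordered componentwise. Let $I$ be generated by monomials $x^{a_1},\ldots,x^{a_t}$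 and $J$ by monomials $x^{b_1},\ldots,x^{b_s}$ (no $b_j$'s if $J=0$). Fix $g\in\mathbb{N}^n$ with $a_i\le g$ and $b_j\le g$ for all $i,j$. The characteristic poset of $I/J$ with respect to $g$ is $P^g_{I/J}=\{c\in\mathbb{N}^n: c\le g,\ a_i\le c \text{ for some } i,\ c\not\ge b_j\text{ for all } j\}$, a finite subposet of $\mathbb{N}^n$. For $a\le b$ in a poset $P$, $[a,b]=\{c\in P: a\le c\le b\}$ is an interval; a partition of a finite poset $P$ is a presentation $P=\bigcup_{i=1}^r[a_i,b_i]$ as a disjoint union of (nonempty) intervals. For $b\in P^g_{I/J}$ set $Z_b=\{x_j: b(j)=g(j)\}$ and $\rho(b)=|Z_b|$. The module $I/J$ is identified with the $K$-span of the monomials in $I\setminus J$. Each partition $\mathcal{P}: P^g_{I/J}=\bigcup_{i=1}^r[c_i,d_i]$ gives the Stanley decomposition $\mathcal{D}(\mathcal{P}): I/J=\bigoplus_{i=1}^r\big(\bigoplus_c x^cK[Z_{d_i}]\big)$, where the inner sum is over all $c\in[c_i,d_i]$ with $c(j)=c_i(j)$ for all $j$ with $x_j\in Z_{d_i}$. *)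

theory Defs
  imports
    Complex_Main
    "HOL-Algebra.Ideal"
    "HOL-Algebra.Module"
    "HOL-Library.Function_Algebras"
    "HOL-Library.Poly_Mapping"
begin

section \<open>The polynomial ring\<close>

text \<open>
  The variables are indexed by a finite type \<open>'n\<close>, so \<open>n = CARD('n)\<close>. A polynomial is a finitely
  supported map from exponent vectors to coefficients; with the pointwise structure on
  \<open>'n \<Rightarrow> nat\<close>, the product of \<open>Poly_Mapping\<close> is the product of polynomials, and \<open>\<le>\<close>
  is the componentwise order on exponent vectors.
\<close>

type_synonym ('n, 'k) mpoly = "('n \<Rightarrow> nat) \<Rightarrow>\<^sub>0 'k"

definition mpoly_ring :: "('n, 'k::field) mpoly ring" where
  "mpoly_ring = \<lparr>carrier = UNIV, mult = (*), one = 1, zero = 0, add = (+)\<rparr>"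

abbreviation x_pow :: "('n \<Rightarrow> nat) \<Rightarrow> ('n, 'k::field) mpoly" where
  "x_pow a \<equiv> Poly_Mapping.single a 1"

definition monomial_ideal :: "('n \<Rightarrow> nat) set \<Rightarrow> ('n, 'k::field) mpoly set" where
  "monomial_ideal A = genideal mpoly_ring (x_pow ` A)"

text \<open>The component of degree \<open>c \<in> \<int>\<^sup>n\<close>; it is \<open>{0}\<close> unless \<open>c \<in> \<nat>\<^sup>n\<close>.\<close>

definition mpoly_component :: "('n \<Rightarrow> int) \<Rightarrow> ('n, 'k::field) mpoly set" where
  "mpoly_component c = {f. \<forall>v \<in> Poly_Mapping.keys f. (\<lambda>i. int (v i)) = c}"

definition monomials_in :: "'n set \<Rightarrow> ('n, 'k::field) mpoly set" where
  "monomials_in Z = x_pow ` {v. \<forall>i. i \<notin> Z \<longrightarrow> v i = 0}"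

text \<open>The subring \<open>K[Z]\<close>.\<close>

definition subpolys :: "'n set \<Rightarrow> ('n, 'k::field) mpoly set" where
  "subpolys Z = {f. \<forall>v \<in> Poly_Mapping.keys f. \<forall>i. i \<notin> Z \<longrightarrow> v i = 0}"


section \<open>Graded modules and Stanley decompositions\<close>

text \<open>A module (in the sense of \<open>HOL-Algebra\<close>) together with its components of degree \<open>'d\<close>.\<close>

record ('a, 'b, 'd) graded_module = "('a, 'b) module" +
  component :: "'d \<Rightarrow> 'b set"

type_synonym ('n, 'k, 'b) mpoly_module = "(('n, 'k) mpoly, 'b, 'n \<Rightarrow> int) graded_module"

definition homogeneous :: "('n, 'k::field, 'b) mpoly_module \<Rightarrow> 'b \<Rightarrow> bool" where
  "homogeneous M u \<longleftrightarrow> (\<exists>c. u \<in> component M c)"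

definition K_subspace :: "('n, 'k::field, 'b) mpoly_module \<Rightarrow> 'b set \<Rightarrow> bool" where
  "K_subspace M N \<longleftrightarrow> N \<subseteq> carrier M \<and> \<zero>\<^bsub>M\<^esub> \<in> N
     \<and> (\<forall>x \<in> N. \<forall>y \<in> N. x \<oplus>\<^bsub>M\<^esub> y \<in> N)
     \<and> (\<forall>k. \<forall>x \<in> N. Poly_Mapping.single 0 k \<odot>\<^bsub>M\<^esub> x \<in> N)"

text \<open>The space \<open>uK[Z]\<close>.\<close>

definition stanley_span ::
  "('n, 'k::field, 'b) mpoly_module \<Rightarrow> 'b \<Rightarrow> 'n set \<Rightarrow> 'b set" where
  "stanley_span M u Z = K_subspace M hull ((\<lambda>v. v \<odot>\<^bsub>M\<^esub> u) ` monomials_in Z)"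

text \<open>A \<open>K[Z]\<close>-basis of a subset \<open>N\<close> of \<open>M\<close> that is stable under \<open>K[Z]\<close>.\<close>

definition subpoly_basis ::
  "('n, 'k::field, 'b) mpoly_module \<Rightarrow> 'n set \<Rightarrow> 'b set \<Rightarrow> 'b set \<Rightarrow> bool" where
  "subpoly_basis M Z N B \<longleftrightarrow> B \<subseteq> N
     \<and> (\<forall>x \<in> N. \<exists>F f. finite F \<and> F \<subseteq> B \<and> f \<in> F \<rightarrow> subpolys Z
           \<and> x = (\<Oplus>\<^bsub>M\<^esub>b\<in>F. f b \<odot>\<^bsub>M\<^esub> b))
     \<and> (\<forall>F f. finite F \<and> F \<subseteq> B \<and> f \<in> F \<rightarrow> subpolys Z
           \<and> (\<Oplus>\<^bsub>M\<^esub>b\<in>F. f b \<odot>\<^bsub>M\<^esub> b) = \<zero>\<^bsub>M\<^esub> \<longrightarrow> (\<forall>b \<in> F. f b = 0))"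

definition stanley_space ::
  "('n, 'k::field, 'b) mpoly_module \<Rightarrow> 'b \<Rightarrow> 'n set \<Rightarrow> bool" where
  "stanley_space M u Z \<longleftrightarrow> u \<in> carrier M \<and> homogeneous M u
     \<and> (\<exists>B. subpoly_basis M Z (stanley_span M u Z) B)"

text \<open>
  A decomposition \<open>M = \<Oplus> u\<^sub>i K[Z\<^sub>i]\<close> is encoded by the finite set of the pairs \<open>(u\<^sub>i, Z\<^sub>i)\<close>. No
  nonzero space occurs twice in a direct sum, so at most repeated zero summands are lost (the zero
  module is free, hence admissible as a summand). The summands are graded subspaces because the
  \<open>u\<^sub>i\<close> are homogeneous, so that a direct sum of vector spaces is one of graded vector spaces.
\<close>

definition stanley_decomposition ::
  "('n, 'k::field, 'b) mpoly_module \<Rightarrow> ('b \<times> 'n set) set \<Rightarrow> bool" where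
  "stanley_decomposition M D \<longleftrightarrow> finite D \<and> (\<forall>(u, Z) \<in> D. stanley_space M u Z)
     \<and> (\<forall>x \<in> carrier M. \<exists>!f. f \<in> (\<Pi>\<^sub>E (u, Z) \<in> D. stanley_span M u Z)
           \<and> x = (\<Oplus>\<^bsub>M\<^esub>p\<in>D. f p))"

definition sdepth_decomposition :: "('b \<times> 'n set) set \<Rightarrow> nat" where
  "sdepth_decomposition D = Min ((\<lambda>(u, Z). card Z) ` D)"

definition sdepth :: "('n::finite, 'k::field, 'b) mpoly_module \<Rightarrow> nat" where
  "sdepth M = Max {sdepth_decomposition D | D. stanley_decomposition M D}"


section \<open>The module \<open>I/J\<close>\<close>

definition quotient_module ::
  "('n, 'k::field) mpoly set \<Rightarrow> ('n, 'k) mpoly set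
     \<Rightarrow> ('n, 'k, ('n, 'k) mpoly set) mpoly_module" where
  "quotient_module I J =
     \<lparr>carrier = (\<lambda>f. J +>\<^bsub>mpoly_ring\<^esub> f) ` I,
      mult = undefined, one = undefined, \<comment> \<open>irrelevant for modules\<close>
      zero = J,
      add = (\<lambda>X Y. X <+>\<^bsub>mpoly_ring\<^esub> Y),
      smult = (\<lambda>s X. \<Union>f\<in>X. J +>\<^bsub>mpoly_ring\<^esub> (s * f)),
      component = (\<lambda>c. (\<lambda>f. J +>\<^bsub>mpoly_ring\<^esub> f) ` (I \<inter> mpoly_component c))\<rparr>"


section \<open>The characteristic poset and its partitions\<close>

text \<open>The sets \<open>A\<close> and \<open>B\<close> consist of the exponents of generators of \<open>I\<close> and \<open>J\<close>.\<close>

definition char_poset ::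
  "('n \<Rightarrow> nat) set \<Rightarrow> ('n \<Rightarrow> nat) set \<Rightarrow> ('n \<Rightarrow> nat) \<Rightarrow> ('n \<Rightarrow> nat) set" where
  "char_poset A B g = {c. c \<le> g \<and> (\<exists>a \<in> A. a \<le> c) \<and> (\<forall>b \<in> B. \<not> b \<le> c)}"

definition interval_in :: "'a::order set \<Rightarrow> 'a \<Rightarrow> 'a \<Rightarrow> 'a set" where
  "interval_in P a b = {c \<in> P. a \<le> c \<and> c \<le> b}"

text \<open>
  A partition into intervals is encoded by the set of pairs of end points; a nonempty interval
  determines its end points.
\<close>

definition interval_partition :: "'a::order set \<Rightarrow> ('a \<times> 'a) set \<Rightarrow> bool" where
  "interval_partition P Q \<longleftrightarrow> finite Q \<and> (\<forall>(c, d) \<in> Q. c \<in> P \<and> d \<in> P \<and> c \<le> d)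
     \<and> P = (\<Union>(c, d) \<in> Q. interval_in P c d)
     \<and> (\<forall>(c, d) \<in> Q. \<forall>(c', d') \<in> Q.
           (c, d) \<noteq> (c', d') \<longrightarrow> interval_in P c d \<inter> interval_in P c' d' = {})"

definition max_vars :: "('n \<Rightarrow> nat) \<Rightarrow> ('n \<Rightarrow> nat) \<Rightarrow> 'n set" where
  "max_vars g b = {j. b j = g j}"

definition rho :: "('n::finite \<Rightarrow> nat) \<Rightarrow> ('n \<Rightarrow> nat) \<Rightarrow> nat" where
  "rho g b = card (max_vars g b)"

text \<open>
  The decomposition \<open>\<D>(\<P>)\<close> of \<open>I/J\<close>; the first components are the residue classes of the
  monomials \<open>x\<^sup>c\<close>.
\<close>

definition partition_decomposition ::
  "('n, 'k::field) mpoly set \<Rightarrow> ('n \<Rightarrow> nat) set \<Rightarrow> ('n \<Rightarrow> nat)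
     \<Rightarrow> (('n \<Rightarrow> nat) \<times> ('n \<Rightarrow> nat)) set \<Rightarrow> (('n, 'k) mpoly set \<times> 'n set) set" where
  "partition_decomposition J P g Q =
     (\<Union>(c', d) \<in> Q. {(J +>\<^bsub>mpoly_ring\<^esub> x_pow c, max_vars g d) | c.
        c \<in> interval_in P c' d \<and> (\<forall>j \<in> max_vars g d. c j = c' j)})"

end

theory Submission
  imports Defs "HOL-Library.Disjoint_Sets"
begin

text \<open>
  \<open>I/J\<close> has the residue classes of the monomials in \<open>I \<setminus> J\<close> as a \<open>K\<close>-basis, and freeness over
  \<open>K[Z]\<close> forces a nonzero Stanley space \<open>uK[Z]\<close> to be spanned by the monomials in a cone
  \<open>c + \<nat>\<^sup>Z\<close> avoiding \<open>J\<close>. So, up to zero summands, a Stanley decomposition is a partition of the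
  exponents of \<open>I \<setminus> J\<close> into finitely many cones. Because membership of \<open>x\<^sup>m\<close> in \<open>I\<close> and \<open>J\<close>
  depends only on \<open>inf m g\<close>, an interval partition of the characteristic poset lifts to such a
  cone partition. Conversely, each cone with apex \<open>c \<le> g\<close> meets the box below \<open>g\<close> in the interval
  from \<open>c\<close> to the vector \<open>d\<close> that is \<open>g\<close> on \<open>Z\<close> and \<open>c\<close> elsewhere; these intervals partition the
  poset and \<open>\<rho>(d) \<ge> |Z|\<close>.
\<close>

section \<open>Supports of polynomials and monomial ideals\<close>

lemma poly_mapping_eq_sum_single:
  "f = (\<Sum>v\<in>Poly_Mapping.keys f. Poly_Mapping.single v (Poly_Mapping.lookup f v))"
  by (rule poly_mapping_eqI)
    (simp add: lookup_sum lookup_single when_def in_keys_iff)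

text \<open>Multiplication by a monomial only shifts exponents, so the factor \<open>p\<close> can
  be read off from the product. This is the cancellation behind the freeness of monomial Stanley
  spaces.\<close>

lemma lookup_times_x_pow:
  fixes p :: "('n, 'k::field) mpoly"
  shows "Poly_Mapping.lookup (p * x_pow c) w =
    (if c \<le> w then Poly_Mapping.lookup p (w - c) else 0)"
proof -
  have eq: "v + c = w \<longleftrightarrow> c \<le> w \<and> v = w - c" for v :: "'n \<Rightarrow> nat"
    by (auto simp: le_fun_def fun_eq_iff)
      (metis le_add2, metis add_diff_cancel_right')
  have "p * x_pow c = (\<Sum>v\<in>Poly_Mapping.keys p.
      Poly_Mapping.single v (Poly_Mapping.lookup p v)) * x_pow c"
    using poly_mapping_eq_sum_single[of p] by simp
  also have "Poly_Mapping.lookup \<dots> w =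
      (\<Sum>v\<in>Poly_Mapping.keys p. if c \<le> w \<and> v = w - c then Poly_Mapping.lookup p v else 0)"
    by (simp add: sum_distrib_right mult_single lookup_sum lookup_single when_def eq)
  also have "\<dots> = (if c \<le> w then Poly_Mapping.lookup p (w - c) else 0)"
    by (simp add: in_keys_iff)
  finally show ?thesis .
qed

lemma mpoly_ring_simps [simp]:
  "carrier mpoly_ring = UNIV" "mult mpoly_ring = (*)" "one mpoly_ring = 1"
  "zero mpoly_ring = 0" "add mpoly_ring = (+)"
  by (simp_all add: mpoly_ring_def)

lemma cring_mpoly_ring: "cring (mpoly_ring :: ('n, 'k::field) mpoly ring)"
proof (rule cringI)
  show "abelian_group (mpoly_ring :: ('n, 'k) mpoly ring)"
  proof (rule abelian_groupI)
    fix x :: "('n, 'k) mpoly"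
    show "\<exists>y\<in>carrier mpoly_ring. y \<oplus>\<^bsub>mpoly_ring\<^esub> x = \<zero>\<^bsub>mpoly_ring\<^esub>"
      by (rule bexI[of _ "- x"]) auto
  qed (auto simp: algebra_simps)
qed (auto intro!: comm_monoidI simp: algebra_simps)

text \<open>These are the exponents of the monomials in the ideal generated by the
  \<open>x_pow a\<close> with \<open>a\<close> in \<open>A\<close>.\<close>

definition upset :: "('n \<Rightarrow> nat) set \<Rightarrow> ('n \<Rightarrow> nat) set" where
  "upset A = {v. \<exists>a\<in>A. a \<le> v}"

lemma upset_add: "v \<in> upset A \<Longrightarrow> u + v \<in> upset A"
  unfolding upset_def by (auto simp: le_fun_def) (meson trans_le_add2)

lemma keys_mult_upset:
  fixes f h :: "('n, 'k::field) mpoly"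
  assumes "Poly_Mapping.keys h \<subseteq> upset A"
  shows "Poly_Mapping.keys (f * h) \<subseteq> upset A"
  using keys_mult[of f h] assms by (fastforce intro: upset_add)

lemma ideal_keys_upset:
  "ideal {f. Poly_Mapping.keys f \<subseteq> upset A} (mpoly_ring :: ('n, 'k::field) mpoly ring)"
proof -
  interpret cring "mpoly_ring :: ('n, 'k) mpoly ring" by (rule cring_mpoly_ring)
  have minus: "\<ominus>\<^bsub>mpoly_ring\<^esub> f = - f" for f :: "('n, 'k) mpoly"
    by (rule minus_equality) auto
  show ?thesis
  proof (rule idealI)
    show "ring (mpoly_ring :: ('n, 'k) mpoly ring)" by (rule ring_axioms)
    show "subgroup {f. Poly_Mapping.keys f \<subseteq> upset A} (add_monoid (mpoly_ring :: ('n, 'k) mpoly ring))"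
    proof (rule add.subgroupI)
      show "{f :: ('n, 'k) mpoly. Poly_Mapping.keys f \<subseteq> upset A} \<noteq> {}"
        by (auto intro: exI[of _ 0])
    next
      fix f h :: "('n, 'k) mpoly"
      assume f: "f \<in> {f. Poly_Mapping.keys f \<subseteq> upset A}"
      then show "\<ominus>\<^bsub>mpoly_ring\<^esub> f \<in> {f. Poly_Mapping.keys f \<subseteq> upset A}"
        by (auto simp: minus in_keys_iff)
      assume "h \<in> {f. Poly_Mapping.keys f \<subseteq> upset A}"
      with f show "f \<oplus>\<^bsub>mpoly_ring\<^esub> h \<in> {f. Poly_Mapping.keys f \<subseteq> upset A}"
        using keys_add[of f h] by auto
    qed auto
  qed (auto simp: mult.commute dest: subsetD[OF keys_mult_upset])
qed

text \<open>A polynomial supported on \<open>upset A\<close> is the sum of its terms, each a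
  multiple of a generator. Conversely, the polynomials with such support form an ideal containing
  the generators. From here on, membership in \<open>I\<close> and \<open>J\<close> is a condition
  on supports.\<close>

lemma monomial_ideal_eq:
  "monomial_ideal A = {f :: ('n, 'k::field) mpoly. Poly_Mapping.keys f \<subseteq> upset A}"
proof -
  interpret cring "mpoly_ring :: ('n, 'k) mpoly ring" by (rule cring_mpoly_ring)
  have "f \<in> genideal mpoly_ring (x_pow ` A)" if f: "Poly_Mapping.keys f \<subseteq> upset A"
    for f :: "('n, 'k) mpoly"
  proof -
    let ?G = "genideal mpoly_ring (x_pow ` A) :: ('n, 'k) mpoly set"
    interpret ideal ?G mpoly_ring
      by (rule genideal_ideal) simp
    have "(\<Sum>v\<in>F. Poly_Mapping.single v (Poly_Mapping.lookup f v)) \<in> ?G"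
      if "finite F" "F \<subseteq> Poly_Mapping.keys f" for F
      using that
    proof (induction F)
      case empty
      then show ?case using additive_subgroup.zero_closed[OF is_additive_subgroup] by simp
    next
      case (insert v F)
      then obtain a where a: "a \<in> A" "a \<le> v" using f by (auto simp: upset_def)
      have "x_pow a \<in> ?G" using genideal_self[of "x_pow ` A"] a by auto
      from I_l_closed[OF this, of "Poly_Mapping.single (v - a) (Poly_Mapping.lookup f v)"]
      have "Poly_Mapping.single (v - a + a) (Poly_Mapping.lookup f v) \<in> ?G"
        by (simp add: mult_single)
      moreover have "v - a + a = v" using a by (auto simp: le_fun_def fun_eq_iff)
      ultimately show ?case
        using insert additive_subgroup.a_closed[OF is_additive_subgroup] by simp
    qed
    then show ?thesis using poly_mapping_eq_sum_single[of f] by (metis finite_keys subset_refl)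
  qed
  moreover have "genideal mpoly_ring (x_pow ` A) \<subseteq> {f :: ('n, 'k) mpoly. Poly_Mapping.keys f \<subseteq> upset A}"
    by (rule genideal_minimal[OF ideal_keys_upset]) (auto simp: upset_def)
  ultimately show ?thesis unfolding monomial_ideal_def by auto
qed

section \<open>Cones of exponents and intervals in the box below \<open>g\<close>\<close>

definition cone :: "('n \<Rightarrow> nat) \<Rightarrow> 'n set \<Rightarrow> ('n \<Rightarrow> nat) set" where
  "cone c Z = {v. c \<le> v \<and> (\<forall>i. i \<notin> Z \<longrightarrow> v i = c i)}"

lemma apex_in_cone: "c \<in> cone c Z"
  by (simp add: cone_def)

lemma mem_char_poset: "c \<in> char_poset A B g \<longleftrightarrow> c \<le> g \<and> c \<in> upset A - upset B"
  by (auto simp: char_poset_def upset_def)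

text \<open>The poset is convex: a point between \<open>c\<close> and \<open>d\<close> inherits a
  generator of \<open>A\<close> below it from \<open>c\<close>, and the absence of one of
  \<open>B\<close> from \<open>d\<close>.\<close>

lemma mem_interval_char_poset:
  assumes "c \<in> char_poset A B g" "d \<in> char_poset A B g"
  shows "interval_in (char_poset A B g) c d = {c..d}"
  using assms by (auto simp: interval_in_def char_poset_def) (meson order_trans)+

text \<open>For \<open>a \<le> g\<close>, the conditions \<open>a \<le> inf m g\<close> and
  \<open>a \<le> m\<close> are equivalent.\<close>

lemma inf_upset:
  fixes m g :: "'n \<Rightarrow> nat"
  assumes "\<forall>a\<in>A. a \<le> g"
  shows "inf m g \<in> upset A \<longleftrightarrow> m \<in> upset A"
  using assms by (auto simp: upset_def)

lemma finite_char_poset: "finite (char_poset A B (g :: 'n::finite \<Rightarrow> nat))"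
proof (rule finite_subset)
  show "char_poset A B g \<subseteq> (\<Pi>\<^sub>E i\<in>UNIV. {..g i})"
    by (auto simp: char_poset_def le_fun_def)
qed (simp add: finite_PiE)

text \<open>The apex is the least element of its cone, so a cone meets the box only if its apex is
  below \<open>g\<close>; \<open>Q\<close> keeps exactly these. The upper end equals
  \<open>g\<close> on \<open>Z p\<close>, hence \<open>max_vars g d\<close> contains
  \<open>Z p\<close>. It is larger if the apex agrees with \<open>g\<close> in a further coordinate,
  which is why only an inequality results.\<close>

lemma cones_interval_partition:
  fixes c :: "'p \<Rightarrow> 'n::finite \<Rightarrow> nat"
  assumes D: "finite D" and disj: "disjoint_family_on (\<lambda>p. cone (c p) (Z p)) D"
    and cover: "(\<Union>p\<in>D. cone (c p) (Z p)) = upset A - upset B"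
    and Q: "Q = (\<lambda>p. (c p, \<lambda>j. if j \<in> Z p then g j else c p j)) ` {p \<in> D. c p \<le> g}"
  shows "interval_partition (char_poset A B g) Q"
    and "(a, d) \<in> Q \<Longrightarrow> \<exists>p\<in>D. card (Z p) \<le> rho g d"
proof -
  \<comment> \<open>For an apex below \<open>g\<close>, this is the greatest point of the cone
    inside the box.\<close>
  define e where "e p = (\<lambda>j. if j \<in> Z p then g j else c p j)" for p
  have Q': "Q = (\<lambda>p. (c p, e p)) ` {p \<in> D. c p \<le> g}" by (simp add: Q e_def)
  have e_cone: "e p \<in> cone (c p) (Z p)" "c p \<le> e p" "e p \<le> g" if "c p \<le> g" for p
    using that by (auto simp: e_def cone_def le_fun_def)
  have ends: "c p \<in> char_poset A B g" "e p \<in> char_poset A B g" if "p \<in> D" "c p \<le> g" for p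
  proof -
    have "cone (c p) (Z p) \<subseteq> upset A - upset B" using cover that by blast
    then show "c p \<in> char_poset A B g" "e p \<in> char_poset A B g"
      using e_cone[of p] apex_in_cone[of "c p" "Z p"] that by (auto simp: mem_char_poset)
  qed
  have int: "interval_in (char_poset A B g) (c p) (e p) = cone (c p) (Z p) \<inter> {..g}"
    if "p \<in> D" "c p \<le> g" for p
  proof -
    have "v \<in> {c p..e p} \<longleftrightarrow> v \<in> cone (c p) (Z p) \<inter> {..g}" for v
      using that(2) by (auto simp: e_def cone_def le_fun_def antisym split: if_splits)
        (metis antisym)+
    then show ?thesis using mem_interval_char_poset[OF ends[OF that]] by auto
  qed
  show "interval_partition (char_poset A B g) Q"
    unfolding interval_partition_def
  proof (intro conjI)
    show "finite Q" using D by (simp add: Q)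
    show "\<forall>(a, d)\<in>Q. a \<in> char_poset A B g \<and> d \<in> char_poset A B g \<and> a \<le> d"
      using ends e_cone by (auto simp: Q')
    have "v \<in> char_poset A B g \<longleftrightarrow>
        (\<exists>p\<in>D. c p \<le> g \<and> v \<in> interval_in (char_poset A B g) (c p) (e p))" for v
    proof
      assume v: "v \<in> char_poset A B g"
      then obtain p where p: "p \<in> D" "v \<in> cone (c p) (Z p)"
        using cover by (auto simp: mem_char_poset)
      moreover have "v \<le> g" using v by (simp add: mem_char_poset)
      moreover have "c p \<le> g" using p \<open>v \<le> g\<close> by (auto simp: cone_def intro: order_trans)
      ultimately show "\<exists>p\<in>D. c p \<le> g \<and> v \<in> interval_in (char_poset A B g) (c p) (e p)"
        using int by blast
    qed (auto simp: interval_in_def)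
    then show "char_poset A B g = (\<Union>(a, d)\<in>Q. interval_in (char_poset A B g) a d)"
      by (auto simp: Q')
    \<comment> \<open>Distinct pairs in \<open>Q\<close> come from distinct indices, so the
      disjointness of the cones carries over.\<close>
    have "interval_in (char_poset A B g) (c p) (e p) \<inter> interval_in (char_poset A B g) (c q) (e q) = {}"
      if "p \<in> D" "q \<in> D" "c p \<le> g" "c q \<le> g" "p \<noteq> q" for p q
      using disjoint_family_onD[OF disj that(1,2,5)] int that by blast
    then show "\<forall>(a, d)\<in>Q. \<forall>(a', d')\<in>Q. (a, d) \<noteq> (a', d') \<longrightarrow>
        interval_in (char_poset A B g) a d \<inter> interval_in (char_poset A B g) a' d' = {}"
      by (fastforce simp: Q')
  qed
  show "\<exists>p\<in>D. card (Z p) \<le> rho g d" if "(a, d) \<in> Q"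
  proof -
    from that obtain p where p: "p \<in> D" "d = e p" by (auto simp: Q')
    have "Z p \<subseteq> max_vars g d" by (auto simp: p e_def max_vars_def)
    then have "card (Z p) \<le> rho g d" by (simp add: rho_def card_mono)
    then show ?thesis using p by blast
  qed
qed

text \<open>For an interval of the poset, these are the exponents of the inner sum in
  \<open>\<D>(\<P>)\<close>; convexity allows a description that does not mention the poset.\<close>

definition piece :: "('n \<Rightarrow> nat) \<Rightarrow> ('n \<Rightarrow> nat) \<Rightarrow> ('n \<Rightarrow> nat) \<Rightarrow> ('n \<Rightarrow> nat) set" where
  "piece g c' d = {c. c' \<le> c \<and> c \<le> d \<and> (\<forall>j\<in>max_vars g d. c j = c' j)}"

text \<open>On \<open>max_vars g d\<close> the apex agrees with \<open>c'\<close>, and off this set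
  the cone fixes the coordinates of \<open>m\<close> at those of \<open>c\<close>. So
  \<open>m\<close> determines the apex, which makes the cones of one interval disjoint, and cutting
  \<open>m\<close> at \<open>g\<close> leads back into the interval.\<close>

lemma cone_piece:
  assumes "d \<le> g" "c \<in> piece g c' d" "m \<in> cone c (max_vars g d)"
  shows "c' \<le> inf m g" "inf m g \<le> d" "c = (\<lambda>j. if j \<in> max_vars g d then c' j else m j)"
proof -
  from assms have c: "c' \<le> c" "c \<le> d" "\<And>j. d j = g j \<Longrightarrow> c j = c' j" "c \<le> m"
    "\<And>j. d j \<noteq> g j \<Longrightarrow> m j = c j"
    by (auto simp: piece_def cone_def max_vars_def)
  show "c' \<le> inf m g" using c assms(1) by (auto intro: order_trans)
  show "inf m g \<le> d"
  proof (rule le_funI)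
    fix j
    show "inf m g j \<le> d j"
      using c(5)[of j] le_funD[OF c(2), of j] by (cases "d j = g j") (auto intro: le_infI1)
  qed
  show "c = (\<lambda>j. if j \<in> max_vars g d then c' j else m j)"
    using c(3,5) by (auto simp: max_vars_def)
qed

lemma ex_cone_piece:
  fixes g :: "'n \<Rightarrow> nat"
  assumes d: "d \<le> g" and m: "c' \<le> inf m g" "inf m g \<le> d"
  shows "\<exists>c\<in>piece g c' d. m \<in> cone c (max_vars g d)"
proof (rule bexI)
  let ?c = "\<lambda>j. if d j = g j then c' j else inf m g j"
  \<comment> \<open>Here \<open>d j < g j\<close>, and the minimum of \<open>m j\<close> and
    \<open>g j\<close> is at most \<open>d j\<close>, so it must be \<open>m j\<close>. The witness
    \<open>?c\<close> therefore agrees with \<open>m\<close> off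
    \<open>max_vars g d\<close>.\<close>
  have less: "m j < g j" if "d j \<noteq> g j" for j
    using that le_funD[OF d, of j] le_funD[OF m(2), of j]
    by (simp add: inf_nat_def min_def split: if_splits)
  have c'm: "c' j \<le> m j" "c' j \<le> inf m g j" "c' j \<le> d j" for j
    using le_funD[OF m(1), of j] le_funD[OF order_trans[OF m], of j] by auto
  show "?c \<in> piece g c' d"
    using m(2) c'm by (auto simp: piece_def max_vars_def le_fun_def)
  show "m \<in> cone ?c (max_vars g d)"
    using less c'm by (auto simp: cone_def max_vars_def le_fun_def inf_nat_def min_def dest: less_imp_le)
qed

text \<open>This provides at least one partition, so that the maximum over all partitions is taken
  over a nonempty set.\<close>

lemma interval_partition_singletons:
  assumes "finite P"
  shows "interval_partition P ((\<lambda>c. (c, c)) ` P)"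
  using assms by (auto simp: interval_partition_def interval_in_def)

section \<open>The subring \<open>K[Z]\<close> and bases over it\<close>

lemma subpolys_single: "v \<in> {v. \<forall>i. i \<notin> Z \<longrightarrow> v i = 0} \<Longrightarrow> Poly_Mapping.single v k \<in> subpolys Z"
  by (auto simp: subpolys_def)

lemma subpolys_zero: "0 \<in> subpolys Z"
  by (simp add: subpolys_def)

lemma subpolys_add: "p \<in> subpolys Z \<Longrightarrow> q \<in> subpolys Z \<Longrightarrow> p + q \<in> subpolys Z"
  using keys_add[of p q] by (auto simp: subpolys_def)

lemma subpolys_mult: "p \<in> subpolys Z \<Longrightarrow> q \<in> subpolys Z \<Longrightarrow> p * q \<in> subpolys Z"
  using keys_mult[of p q] unfolding subpolys_def by (auto dest!: subsetD)

lemma subpoly_basisD: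
  assumes "subpoly_basis N Z U E"
  shows "E \<subseteq> U"
    and "x \<in> U \<Longrightarrow> \<exists>F f. finite F \<and> F \<subseteq> E \<and> f \<in> F \<rightarrow> subpolys Z \<and> x = (\<Oplus>\<^bsub>N\<^esub>b\<in>F. f b \<odot>\<^bsub>N\<^esub> b)"
    and "\<lbrakk>finite F; F \<subseteq> E; f \<in> F \<rightarrow> subpolys Z; (\<Oplus>\<^bsub>N\<^esub>b\<in>F. f b \<odot>\<^bsub>N\<^esub> b) = \<zero>\<^bsub>N\<^esub>; b \<in> F\<rbrakk> \<Longrightarrow> f b = 0"
proof -
  note * = assms[unfolded subpoly_basis_def]
  show "E \<subseteq> U" by (rule conjunct1[OF *])
  show "x \<in> U \<Longrightarrow> \<exists>F f. finite F \<and> F \<subseteq> E \<and> f \<in> F \<rightarrow> subpolys Z \<and> x = (\<Oplus>\<^bsub>N\<^esub>b\<in>F. f b \<odot>\<^bsub>N\<^esub> b)"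
    by (rule bspec[OF conjunct1[OF conjunct2[OF *]]])
  show "f b = 0" if "finite F" "F \<subseteq> E" "f \<in> F \<rightarrow> subpolys Z"
    "(\<Oplus>\<^bsub>N\<^esub>b\<in>F. f b \<odot>\<^bsub>N\<^esub> b) = \<zero>\<^bsub>N\<^esub>" "b \<in> F"
  proof -
    have "\<forall>b\<in>F. f b = 0"
      by (rule mp[OF spec[OF spec[OF conjunct2[OF conjunct2[OF *]]]]]) (intro conjI that(1-4))
    then show ?thesis using that(5) by (rule bspec)
  qed
qed

section \<open>Computing in \<open>I/J\<close> with representatives\<close>

locale monomial_quotient =
  fixes A B :: "('n::finite \<Rightarrow> nat) set"
    and I J :: "('n, 'k::field) mpoly set"
  assumes I_eq: "I = monomial_ideal A" and J_eq: "J = monomial_ideal B"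
    and J_subset_I: "J \<subseteq> I"
begin

abbreviation M :: "('n, 'k, ('n, 'k) mpoly set) mpoly_module" where
  "M \<equiv> quotient_module I J"

definition cl :: "('n, 'k) mpoly \<Rightarrow> ('n, 'k) mpoly set" where
  "cl f = J +>\<^bsub>mpoly_ring\<^esub> f"

lemma mem_I: "f \<in> I \<longleftrightarrow> Poly_Mapping.keys f \<subseteq> upset A"
  by (simp add: I_eq monomial_ideal_eq)

lemma mem_J: "f \<in> J \<longleftrightarrow> Poly_Mapping.keys f \<subseteq> upset B"
  by (simp add: J_eq monomial_ideal_eq)

lemma x_pow_mem_I: "x_pow c \<in> I \<longleftrightarrow> c \<in> upset A"
  by (simp add: mem_I)

lemma x_pow_mem_J: "x_pow c \<in> J \<longleftrightarrow> c \<in> upset B"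
  by (simp add: mem_J)

lemma I_closed:
  "0 \<in> I" "f \<in> I \<Longrightarrow> h \<in> I \<Longrightarrow> f + h \<in> I" "f \<in> I \<Longrightarrow> p * f \<in> I"
  using keys_add[of f h] keys_mult_upset[of f A p] by (auto simp: mem_I)

lemma J_closed:
  "0 \<in> J" "f \<in> J \<Longrightarrow> h \<in> J \<Longrightarrow> f + h \<in> J" "f \<in> J \<Longrightarrow> p * f \<in> J"
  using keys_add[of f h] keys_mult_upset[of f B p] by (auto simp: mem_J)

lemma J_uminus: "f \<in> J \<Longrightarrow> - f \<in> J"
  by (auto simp: mem_J in_keys_iff)

lemma J_diff: "f \<in> J \<Longrightarrow> h \<in> J \<Longrightarrow> f - h \<in> J"
  using J_closed(2)[of f "- h"] J_uminus[of h] by simp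

lemma mem_cl: "x \<in> cl f \<longleftrightarrow> x - f \<in> J"
proof -
  have "(\<exists>h\<in>J. x = h + f) \<longleftrightarrow> x - f \<in> J" by (metis add_diff_cancel_right' diff_add_cancel)
  then show ?thesis by (simp add: cl_def a_r_coset_def')
qed

lemma cl_eq_iff: "cl f = cl h \<longleftrightarrow> f - h \<in> J"
proof
  assume "cl f = cl h"
  moreover have "f \<in> cl f" by (simp add: mem_cl J_closed)
  ultimately show "f - h \<in> J" by (simp add: mem_cl)
next
  assume *: "f - h \<in> J"
  have "x - f \<in> J \<longleftrightarrow> x - h \<in> J" for x
    using J_closed(2)[OF _ *, of "x - f"] J_diff[OF _ *, of "x - h"] by auto
  then show "cl f = cl h" by (auto simp: mem_cl)
qed

lemma carrier_M: "carrier M = cl ` I"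
  by (simp add: quotient_module_def cl_def)

lemma zero_M: "\<zero>\<^bsub>M\<^esub> = cl 0"
proof -
  have "cl 0 = J" by (auto simp: mem_cl)
  then show ?thesis by (simp add: quotient_module_def)
qed

lemma add_M: "cl f \<oplus>\<^bsub>M\<^esub> cl h = cl (f + h)"
proof -
  have "\<exists>a\<in>cl f. \<exists>b\<in>cl h. x = a + b" if "x \<in> cl (f + h)" for x
    using that by (intro bexI[of _ "x - h"] bexI[of _ h]) (auto simp: mem_cl J_closed diff_diff_eq add.commute)
  moreover have "a + b \<in> cl (f + h)" if "a \<in> cl f" "b \<in> cl h" for a b
    using J_closed(2)[of "a - f" "b - h"] that by (simp add: mem_cl algebra_simps)
  ultimately show ?thesis
    by (auto simp: quotient_module_def set_add_def')
qed

text \<open>The union defining scalar multiplication runs over a constant family, since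
  \<open>J\<close> absorbs multiples of the difference of two representatives.\<close>

lemma smult_M: "s \<odot>\<^bsub>M\<^esub> cl f = cl (s * f)"
proof -
  have "cl (s * h) = cl (s * f)" if "h \<in> cl f" for h
    using J_closed(3)[of "h - f" s] that by (simp add: mem_cl cl_eq_iff right_diff_distrib)
  moreover have "f \<in> cl f" by (simp add: mem_cl J_closed)
  moreover have "s \<odot>\<^bsub>M\<^esub> cl f = (\<Union>h\<in>cl f. cl (s * h))"
    by (simp add: quotient_module_def cl_def)
  ultimately show ?thesis by blast
qed

lemma component_M: "component M c = cl ` (I \<inter> mpoly_component c)"
  by (simp add: quotient_module_def cl_def)

lemma abelian_monoid_M: "abelian_monoid M"
proof (rule abelian_monoidI)
qed (auto simp: carrier_M zero_M add_M I_closed add_ac intro!: imageI)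

lemma finsum_cl:
  assumes "finite D" "\<And>p. p \<in> D \<Longrightarrow> h p \<in> I"
  shows "(\<Oplus>\<^bsub>M\<^esub>p\<in>D. cl (h p)) = cl (\<Sum>p\<in>D. h p)"
proof -
  interpret abelian_monoid M by (rule abelian_monoid_M)
  from assms show ?thesis
  proof (induction D)
    case (insert p D)
    then have "(\<lambda>p. cl (h p)) \<in> D \<rightarrow> carrier M" by (auto simp: carrier_M)
    with insert show ?case
      by (simp add: finsum_insert add_M carrier_M)
  qed (simp add: zero_M)
qed

text \<open>The multiples of \<open>cl w\<close> by \<open>K[Z]\<close> form a
  \<open>K\<close>-subspace, so minimality of the hull gives one inclusion. For the other, a
  subspace containing the monomial multiples contains every multiple, by induction over the terms of
  the polynomial factor.\<close>

lemma stanley_span_cl: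
  assumes "w \<in> I"
  shows "stanley_span M (cl w) Z = (\<lambda>p. cl (p * w)) ` subpolys Z"
proof
  let ?R = "(\<lambda>p. cl (p * w)) ` subpolys Z"
  have "K_subspace M ?R"
    unfolding K_subspace_def
  proof (intro conjI ballI allI)
    show "?R \<subseteq> carrier M" using assms by (auto simp: carrier_M I_closed)
    show "\<zero>\<^bsub>M\<^esub> \<in> ?R"
      by (intro image_eqI[of _ _ 0]) (auto simp: zero_M subpolys_zero)
    show "x \<oplus>\<^bsub>M\<^esub> y \<in> ?R" if x: "x \<in> ?R" and y: "y \<in> ?R" for x y
    proof -
      from x obtain p where p: "p \<in> subpolys Z" "x = cl (p * w)" by auto
      from y obtain q where q: "q \<in> subpolys Z" "y = cl (q * w)" by auto
      have "x \<oplus>\<^bsub>M\<^esub> y = cl ((p + q) * w)" by (simp add: p q add_M distrib_right)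
      then show ?thesis using subpolys_add[OF p(1) q(1)] by auto
    qed
    show "Poly_Mapping.single 0 k \<odot>\<^bsub>M\<^esub> x \<in> ?R" if x: "x \<in> ?R" for k x
    proof -
      from x obtain p where p: "p \<in> subpolys Z" "x = cl (p * w)" by auto
      have "Poly_Mapping.single 0 k \<odot>\<^bsub>M\<^esub> x = cl ((Poly_Mapping.single 0 k * p) * w)"
        by (simp add: p smult_M mult.assoc)
      moreover have "Poly_Mapping.single 0 k * p \<in> subpolys Z"
        by (intro subpolys_mult p subpolys_single) auto
      ultimately show ?thesis by auto
    qed
  qed
  moreover have "(\<lambda>v. v \<odot>\<^bsub>M\<^esub> cl w) ` monomials_in Z \<subseteq> ?R"
    by (auto simp: monomials_in_def smult_M intro!: imageI subpolys_single)
  ultimately show "stanley_span M (cl w) Z \<subseteq> ?R"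
    unfolding stanley_span_def by (rule hull_minimal[rotated])
next
  have "cl (p * w) \<in> N" if p: "p \<in> subpolys Z"
    and N: "K_subspace M N" "(\<lambda>v. v \<odot>\<^bsub>M\<^esub> cl w) ` monomials_in Z \<subseteq> N" for p N
  proof -
    have "cl ((\<Sum>v\<in>F. Poly_Mapping.single v (Poly_Mapping.lookup p v)) * w) \<in> N"
      if "finite F" "F \<subseteq> Poly_Mapping.keys p" for F
      using that
    proof (induction F)
      case empty
      then show ?case using N by (simp add: K_subspace_def zero_M)
    next
      case (insert v F)
      have "x_pow v \<in> monomials_in Z"
        using p insert.prems by (auto simp: subpolys_def monomials_in_def)
      then have "cl (x_pow v * w) \<in> N" using N by (auto simp: smult_M)
      then have "Poly_Mapping.single 0 (Poly_Mapping.lookup p v) \<odot>\<^bsub>M\<^esub> cl (x_pow v * w) \<in> N"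
        using N unfolding K_subspace_def by blast
      moreover have "Poly_Mapping.single 0 (Poly_Mapping.lookup p v) * (x_pow v * w) =
          Poly_Mapping.single v (Poly_Mapping.lookup p v) * w"
        by (simp add: mult.assoc[symmetric] mult_single)
      ultimately have "cl (Poly_Mapping.single v (Poly_Mapping.lookup p v) * w) \<in> N"
        by (simp add: smult_M)
      then have "cl (Poly_Mapping.single v (Poly_Mapping.lookup p v) * w) \<oplus>\<^bsub>M\<^esub>
          cl ((\<Sum>v\<in>F. Poly_Mapping.single v (Poly_Mapping.lookup p v)) * w) \<in> N"
        using N insert unfolding K_subspace_def by blast
      then show ?case using insert by (simp add: add_M distrib_right)
    qed
    then show ?thesis using poly_mapping_eq_sum_single[of p] by (metis finite_keys subset_refl)
  qed
  then show "(\<lambda>p. cl (p * w)) ` subpolys Z \<subseteq> stanley_span M (cl w) Z"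
    unfolding stanley_span_def hull_def by blast
qed

section \<open>The monomial basis of \<open>I/J\<close>; direct sums as partitions of
  exponents\<close>

definition mons :: "('n \<Rightarrow> nat) set" where
  "mons = upset A - upset B"

text \<open>The difference of the two polynomials is supported in \<open>upset B\<close>, which is
  disjoint from \<open>mons\<close>. Thus monomials outside \<open>J\<close> stay linearly
  independent modulo \<open>J\<close>.\<close>

lemma cl_inject:
  assumes "cl f = cl h" "Poly_Mapping.keys f \<subseteq> mons" "Poly_Mapping.keys h \<subseteq> mons"
  shows "f = h"
proof (rule poly_mapping_eqI)
  fix v
  have *: "Poly_Mapping.keys (f - h) \<subseteq> upset B" using assms(1) by (simp add: cl_eq_iff mem_J)
  show "Poly_Mapping.lookup f v = Poly_Mapping.lookup h v"
  proof (cases "v \<in> mons")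
    case True
    then have "v \<notin> Poly_Mapping.keys (f - h)" using * by (auto simp: mons_def)
    then show ?thesis by (simp add: in_keys_iff lookup_minus)
  next
    case False
    then have "v \<notin> Poly_Mapping.keys f" "v \<notin> Poly_Mapping.keys h" using assms by auto
    then show ?thesis by (simp add: in_keys_iff)
  qed
qed

lemma mons_subset_I: "Poly_Mapping.keys f \<subseteq> T \<Longrightarrow> T \<subseteq> mons \<Longrightarrow> f \<in> I"
  unfolding mem_I mons_def by blast

text \<open>Choosing polynomial representatives turns a sum in \<open>M\<close> into a sum of
  polynomials, where coefficients can be compared. The restriction to \<open>D\<close> matches the
  default value of extensional functions outside \<open>D\<close>.\<close>

lemma finsum_representatives:
  assumes D: "finite D" and T: "\<forall>p\<in>D. T p \<subseteq> mons"
    and f: "f \<in> (\<Pi>\<^sub>E p\<in>D. cl ` {h. Poly_Mapping.keys h \<subseteq> T p})"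
  shows "\<exists>h. (\<forall>p\<in>D. Poly_Mapping.keys (h p) \<subseteq> T p) \<and> f = restrict (\<lambda>p. cl (h p)) D
    \<and> (\<Oplus>\<^bsub>M\<^esub>p\<in>D. f p) = cl (\<Sum>p\<in>D. h p)"
proof -
  interpret abelian_monoid M by (rule abelian_monoid_M)
  have "\<exists>h. \<forall>p\<in>D. Poly_Mapping.keys (h p) \<subseteq> T p \<and> f p = cl (h p)"
    using f by (intro bchoice) fastforce
  then obtain h where h: "\<And>p. p \<in> D \<Longrightarrow> Poly_Mapping.keys (h p) \<subseteq> T p"
    "\<And>p. p \<in> D \<Longrightarrow> f p = cl (h p)"
    by blast
  have hI: "h p \<in> I" if "p \<in> D" for p
    using mons_subset_I[OF h(1)] T that by blast
  have "(\<Oplus>\<^bsub>M\<^esub>p\<in>D. f p) = (\<Oplus>\<^bsub>M\<^esub>p\<in>D. cl (h p))"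
    by (rule finsum_cong') (auto simp: h carrier_M hI)
  also have "\<dots> = cl (\<Sum>p\<in>D. h p)" by (rule finsum_cl[OF D hI])
  finally have "(\<Oplus>\<^bsub>M\<^esub>p\<in>D. f p) = cl (\<Sum>p\<in>D. h p)" .
  moreover have "f = restrict (\<lambda>p. cl (h p)) D"
  proof
    fix p
    show "f p = restrict (\<lambda>p. cl (h p)) D p"
      using h(2)[of p] PiE_arb[OF f, of p] by (cases "p \<in> D") simp_all
  qed
  ultimately show ?thesis using h(1) by blast
qed

lemma finsum_restrict_cl:
  assumes "finite D" "\<And>p. p \<in> D \<Longrightarrow> h p \<in> I"
  shows "(\<Oplus>\<^bsub>M\<^esub>p\<in>D. restrict (\<lambda>p. cl (h p)) D p) = cl (\<Sum>p\<in>D. h p)"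
proof -
  interpret abelian_monoid M by (rule abelian_monoid_M)
  have "(\<Oplus>\<^bsub>M\<^esub>p\<in>D. restrict (\<lambda>p. cl (h p)) D p) = (\<Oplus>\<^bsub>M\<^esub>p\<in>D. cl (h p))"
    by (rule finsum_cong') (auto simp: carrier_M assms)
  then show ?thesis using finsum_cl[OF assms] by simp
qed

text \<open>An exponent in two parts would give the class of its monomial two expressions, one in
  each summand. An exponent of \<open>mons\<close> in no part would give a monomial whose class
  cannot be expressed at all.\<close>

lemma direct_sum_imp_partition:
  fixes D :: "'p set"
  assumes D: "finite D" and T: "\<And>p. p \<in> D \<Longrightarrow> T p \<subseteq> mons"
    and sum: "\<And>x. x \<in> carrier M \<Longrightarrow>
      \<exists>!f. f \<in> (\<Pi>\<^sub>E p\<in>D. cl ` {h. Poly_Mapping.keys h \<subseteq> T p}) \<and> x = (\<Oplus>\<^bsub>M\<^esub>p\<in>D. f p)"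
  shows "disjoint_family_on T D" "(\<Union>p\<in>D. T p) = mons"
proof -
  have "False" if pq: "p \<in> D" "q \<in> D" "p \<noteq> q" "m \<in> T p" "m \<in> T q" for p q m
  proof -
    \<comment> \<open>The family \<open>h r\<close> places the whole monomial in the summand with
      index \<open>r\<close>.\<close>
    define h :: "'p \<Rightarrow> 'p \<Rightarrow> ('n, 'k) mpoly" where "h r s = (if s = r then x_pow m else 0)" for r s
    have mA: "m \<in> upset A" using T[OF pq(1)] pq by (auto simp: mons_def)
    have "restrict (\<lambda>p. cl (h r p)) D \<in> (\<Pi>\<^sub>E p\<in>D. cl ` {h. Poly_Mapping.keys h \<subseteq> T p})
        \<and> cl (x_pow m) = (\<Oplus>\<^bsub>M\<^esub>p\<in>D. restrict (\<lambda>p. cl (h r p)) D p)"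
      if r: "r \<in> D" "m \<in> T r" for r
    proof
      show "restrict (\<lambda>p. cl (h r p)) D \<in> (\<Pi>\<^sub>E p\<in>D. cl ` {h. Poly_Mapping.keys h \<subseteq> T p})"
        using r by (intro restrict_PiE_iff[THEN iffD2] ballI imageI) (auto simp: h_def)
      have "(\<Sum>p\<in>D. h r p) = x_pow m" unfolding h_def using D r by simp
      moreover have "h r p \<in> I" for p using mA by (simp add: h_def x_pow_mem_I I_closed)
      ultimately show "cl (x_pow m) = (\<Oplus>\<^bsub>M\<^esub>p\<in>D. restrict (\<lambda>p. cl (h r p)) D p)"
        using finsum_restrict_cl[OF D, of "h r"] by simp
    qed
    note both = this[OF pq(1,4)] this[OF pq(2,5)]
    have "cl (x_pow m) \<in> carrier M" using mA by (simp add: carrier_M x_pow_mem_I)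
    then have "\<exists>\<^sub>\<le>\<^sub>1f. f \<in> (\<Pi>\<^sub>E p\<in>D. cl ` {h. Poly_Mapping.keys h \<subseteq> T p})
        \<and> cl (x_pow m) = (\<Oplus>\<^bsub>M\<^esub>p\<in>D. f p)"
      by (rule sum[unfolded ex1_iff_ex_Uniq, THEN conjunct2])
    from Uniq_D[OF this, OF both] have "restrict (\<lambda>s. cl (h p s)) D = restrict (\<lambda>s. cl (h q s)) D" .
    then have "cl (h p p) = cl (h q p)" using pq(1) by (metis restrict_apply')
    then have "x_pow m \<in> J" using pq(3) by (simp add: h_def cl_eq_iff)
    then show False using T[OF pq(1)] pq by (auto simp: x_pow_mem_J mons_def)
  qed
  then show "disjoint_family_on T D" by (auto simp: disjoint_family_on_def)
  have "\<exists>p\<in>D. m \<in> T p" if m: "m \<in> mons" for m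
  proof -
    have "cl (x_pow m) \<in> carrier M" using m by (simp add: carrier_M x_pow_mem_I mons_def)
    from ex1_implies_ex[OF sum[OF this]]
    obtain f where f: "f \<in> (\<Pi>\<^sub>E p\<in>D. cl ` {h. Poly_Mapping.keys h \<subseteq> T p})"
      "cl (x_pow m) = (\<Oplus>\<^bsub>M\<^esub>p\<in>D. f p)"
      by (elim exE conjE)
    obtain h where h: "\<forall>p\<in>D. Poly_Mapping.keys (h p) \<subseteq> T p"
      "(\<Oplus>\<^bsub>M\<^esub>p\<in>D. f p) = cl (\<Sum>p\<in>D. h p)"
      using finsum_representatives[OF D _ f(1)] T by auto
    have "Poly_Mapping.keys (x_pow m - (\<Sum>p\<in>D. h p)) \<subseteq> upset B"
      using f(2) h(2) by (simp add: cl_eq_iff mem_J)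
    \<comment> \<open>Passing modulo \<open>J\<close> does not affect the coefficient at
      \<open>m\<close>, because \<open>m\<close> lies outside \<open>upset B\<close>.\<close>
    then have "Poly_Mapping.lookup (x_pow m - (\<Sum>p\<in>D. h p)) m = 0"
      using m by (auto simp: mons_def in_keys_iff)
    then have "(\<Sum>p\<in>D. Poly_Mapping.lookup (h p) m) \<noteq> 0"
      by (simp add: lookup_minus lookup_sum)
    then obtain p where "p \<in> D" "Poly_Mapping.lookup (h p) m \<noteq> 0"
      using sum.not_neutral_contains_not_neutral by blast
    then show ?thesis using h(1) by (metis in_keys_iff subsetD)
  qed
  then show "(\<Union>p\<in>D. T p) = mons" using T by blast
qed

text \<open>For existence, a representative is split into its restrictions to the parts; the terms
  left over have exponents outside \<open>mons\<close> and lie in \<open>J\<close>. For uniqueness,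
  the coefficient of a sum at an exponent of \<open>T p\<close> comes from the summand
  \<open>p\<close> alone and is not changed modulo \<open>J\<close>.\<close>

lemma partition_imp_direct_sum:
  fixes D :: "'p set"
  assumes D: "finite D" and disj: "disjoint_family_on T D" and cover: "(\<Union>p\<in>D. T p) = mons"
    and x: "x \<in> carrier M"
  shows "\<exists>!f. f \<in> (\<Pi>\<^sub>E p\<in>D. cl ` {h. Poly_Mapping.keys h \<subseteq> T p}) \<and> x = (\<Oplus>\<^bsub>M\<^esub>p\<in>D. f p)"
proof (rule ex_ex1I)
  have T: "T p \<subseteq> mons" if "p \<in> D" for p using that cover by blast
  have lookup: "(\<Sum>q\<in>D. Poly_Mapping.lookup (h q) v) = Poly_Mapping.lookup (h p) v"
    if h: "\<And>q. q \<in> D \<Longrightarrow> Poly_Mapping.keys (h q) \<subseteq> T q" and p: "p \<in> D" "v \<in> T p"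
    for h :: "'p \<Rightarrow> ('n, 'k) mpoly" and p v
  proof -
    have "Poly_Mapping.lookup (h q) v = 0" if q: "q \<in> D" "q \<noteq> p" for q
    proof (rule ccontr)
      assume "Poly_Mapping.lookup (h q) v \<noteq> 0"
      then have "v \<in> T q" using h[OF q(1)] by (auto simp: in_keys_iff)
      then show False using disj p q by (auto simp: disjoint_family_on_def)
    qed
    then have "(\<Sum>q\<in>D. Poly_Mapping.lookup (h q) v) = (\<Sum>q\<in>{p}. Poly_Mapping.lookup (h q) v)"
      using D p by (intro sum.mono_neutral_right) auto
    then show ?thesis by simp
  qed
  obtain f where f: "x = cl f" "f \<in> I" using x by (auto simp: carrier_M)
  \<comment> \<open>The polynomial \<open>r p\<close> keeps the terms of \<open>f\<close> with
    exponent in \<open>T p\<close> and drops all others.\<close>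
  define r :: "'p \<Rightarrow> ('n, 'k) mpoly" where "r p = Poly_Mapping.mapp (\<lambda>v k. k when v \<in> T p) f" for p
  have lookup_r: "Poly_Mapping.lookup (r p) v = (Poly_Mapping.lookup f v when v \<in> T p)" for p v
    by (auto simp: r_def lookup_mapp when_def in_keys_iff)
  have keys_r: "Poly_Mapping.keys (r p) \<subseteq> T p" for p
    by (auto simp: in_keys_iff lookup_r)
  have rI: "r p \<in> I" if "p \<in> D" for p
    using mons_subset_I[OF keys_r T] that .
  have "f - (\<Sum>p\<in>D. r p) \<in> J"
    unfolding mem_J
  proof
    fix v assume v: "v \<in> Poly_Mapping.keys (f - (\<Sum>p\<in>D. r p))"
    then have ne: "Poly_Mapping.lookup f v \<noteq> (\<Sum>p\<in>D. Poly_Mapping.lookup (r p) v)"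
      by (simp add: in_keys_iff lookup_minus lookup_sum)
    show "v \<in> upset B"
    proof (rule ccontr)
      assume nB: "v \<notin> upset B"
      \<comment> \<open>If this coefficient were zero, all coefficients of the \<open>r p\<close> at
        \<open>v\<close> would vanish too, contrary to \<open>ne\<close>.\<close>
      have "Poly_Mapping.lookup f v \<noteq> 0"
        using ne by (auto simp: lookup_r)
      then have "v \<in> mons" using f nB by (auto simp: mem_I mons_def in_keys_iff)
      then obtain p where "p \<in> D" "v \<in> T p" using cover by blast
      then show False using lookup[of r p v] keys_r ne by (simp add: lookup_r)
    qed
  qed
  then have "x = cl (\<Sum>p\<in>D. r p)" by (simp add: f cl_eq_iff)
  then have "x = (\<Oplus>\<^bsub>M\<^esub>p\<in>D. restrict (\<lambda>p. cl (r p)) D p)"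
    using finsum_restrict_cl[OF D rI] by simp
  moreover have "restrict (\<lambda>p. cl (r p)) D \<in> (\<Pi>\<^sub>E p\<in>D. cl ` {h. Poly_Mapping.keys h \<subseteq> T p})"
    using keys_r by auto
  ultimately show "\<exists>f. f \<in> (\<Pi>\<^sub>E p\<in>D. cl ` {h. Poly_Mapping.keys h \<subseteq> T p})
      \<and> x = (\<Oplus>\<^bsub>M\<^esub>p\<in>D. f p)" by blast
  fix f1 f2 :: "'p \<Rightarrow> ('n, 'k) mpoly set"
  assume f1: "f1 \<in> (\<Pi>\<^sub>E p\<in>D. cl ` {h. Poly_Mapping.keys h \<subseteq> T p}) \<and> x = (\<Oplus>\<^bsub>M\<^esub>p\<in>D. f1 p)"
    and f2: "f2 \<in> (\<Pi>\<^sub>E p\<in>D. cl ` {h. Poly_Mapping.keys h \<subseteq> T p}) \<and> x = (\<Oplus>\<^bsub>M\<^esub>p\<in>D. f2 p)"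
  from f1 have "\<exists>h. (\<forall>p\<in>D. Poly_Mapping.keys (h p) \<subseteq> T p) \<and> f1 = restrict (\<lambda>p. cl (h p)) D
      \<and> (\<Oplus>\<^bsub>M\<^esub>p\<in>D. f1 p) = cl (\<Sum>p\<in>D. h p)"
    by (intro finsum_representatives[OF D]) (simp_all add: T)
  then obtain h1 where h1: "\<And>p. p \<in> D \<Longrightarrow> Poly_Mapping.keys (h1 p) \<subseteq> T p"
    "f1 = restrict (\<lambda>p. cl (h1 p)) D" "(\<Oplus>\<^bsub>M\<^esub>p\<in>D. f1 p) = cl (\<Sum>p\<in>D. h1 p)"
    by blast
  from f2 have "\<exists>h. (\<forall>p\<in>D. Poly_Mapping.keys (h p) \<subseteq> T p) \<and> f2 = restrict (\<lambda>p. cl (h p)) D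
      \<and> (\<Oplus>\<^bsub>M\<^esub>p\<in>D. f2 p) = cl (\<Sum>p\<in>D. h p)"
    by (intro finsum_representatives[OF D]) (simp_all add: T)
  then obtain h2 where h2: "\<And>p. p \<in> D \<Longrightarrow> Poly_Mapping.keys (h2 p) \<subseteq> T p"
    "f2 = restrict (\<lambda>p. cl (h2 p)) D" "(\<Oplus>\<^bsub>M\<^esub>p\<in>D. f2 p) = cl (\<Sum>p\<in>D. h2 p)"
    by blast
  have J: "Poly_Mapping.keys ((\<Sum>p\<in>D. h1 p) - (\<Sum>p\<in>D. h2 p)) \<subseteq> upset B"
    using h1(3) h2(3) f1 f2 by (simp add: cl_eq_iff[symmetric] mem_J[symmetric])
  have "h1 p = h2 p" if p: "p \<in> D" for p
  proof (rule poly_mapping_eqI)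
    fix v
    show "Poly_Mapping.lookup (h1 p) v = Poly_Mapping.lookup (h2 p) v"
    proof (cases "v \<in> T p")
      case True
      then have "v \<notin> Poly_Mapping.keys ((\<Sum>p\<in>D. h1 p) - (\<Sum>p\<in>D. h2 p))"
        using J T[OF p] by (auto simp: mons_def)
      then have "(\<Sum>p\<in>D. Poly_Mapping.lookup (h1 p) v) = (\<Sum>p\<in>D. Poly_Mapping.lookup (h2 p) v)"
        by (simp add: in_keys_iff lookup_minus lookup_sum)
      then show ?thesis using lookup[OF h1(1) p True] lookup[OF h2(1) p True] by simp
    next
      case False
      then have "v \<notin> Poly_Mapping.keys (h1 p)" "v \<notin> Poly_Mapping.keys (h2 p)"
        using h1(1) h2(1) p by auto
      then show ?thesis by (simp add: in_keys_iff)
    qed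
  qed
  then show "f1 = f2" unfolding h1(2) h2(2) by (intro restrict_ext) simp
qed

section \<open>Stanley spaces of \<open>I/J\<close> and their cones\<close>

lemma stanley_span_single:
  assumes "c \<in> upset A" "k \<noteq> 0"
  shows "stanley_span M (cl (Poly_Mapping.single c k)) Z = cl ` {h. Poly_Mapping.keys h \<subseteq> cone c Z}"
proof -
  let ?w = "Poly_Mapping.single c k :: ('n, 'k) mpoly"
  have "?w \<in> I" using assms by (simp add: mem_I)
  moreover have "(\<lambda>p. p * ?w) ` subpolys Z = {h. Poly_Mapping.keys h \<subseteq> cone c Z}"
  proof
    show "(\<lambda>p. p * ?w) ` subpolys Z \<subseteq> {h. Poly_Mapping.keys h \<subseteq> cone c Z}"
    proof clarsimp
      fix p v assume p: "p \<in> subpolys Z" and "v \<in> Poly_Mapping.keys (p * ?w)"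
      then obtain u where "u \<in> Poly_Mapping.keys p" "v = u + c"
        using keys_mult[of p ?w] by (auto split: if_splits)
      then show "v \<in> cone c Z" using p by (auto simp: subpolys_def cone_def le_fun_def)
    qed
    have "h \<in> (\<lambda>p. p * ?w) ` subpolys Z" if h: "Poly_Mapping.keys h \<subseteq> cone c Z" for h :: "('n, 'k) mpoly"
    proof -
      \<comment> \<open>This is the quotient of \<open>h\<close> by the monomial
        \<open>x_pow c\<close>, obtained by shifting exponents back; the scalar \<open>k\<close> is
        divided out afterwards.\<close>
      define q where "q = Poly_Mapping.map_key (\<lambda>v. v + c) h"
      have inj: "inj (\<lambda>v. v + c)" by (simp add: inj_def)
      have lookup_q: "Poly_Mapping.lookup q v = Poly_Mapping.lookup h (v + c)" for v
        using inj by (simp add: q_def map_key.rep_eq)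
      have q: "q \<in> subpolys Z"
        using h by (auto simp: subpolys_def in_keys_iff lookup_q cone_def)
      have "q * x_pow c = h"
      proof (rule poly_mapping_eqI)
        fix v
        have "v - c + c = v" if "c \<le> v" using that by (auto simp: le_fun_def fun_eq_iff)
        moreover have "Poly_Mapping.lookup h v = 0" if "\<not> c \<le> v"
          using that h by (auto simp: cone_def in_keys_iff)
        ultimately show "Poly_Mapping.lookup (q * x_pow c) v = Poly_Mapping.lookup h v"
          by (simp add: lookup_times_x_pow lookup_q)
      qed
      moreover have "x_pow c = Poly_Mapping.single 0 (inverse k) * ?w"
        using assms(2) by (simp add: mult_single)
      ultimately have "h = (q * Poly_Mapping.single 0 (inverse k)) * ?w"
        by (simp add: mult.assoc)
      moreover have "q * Poly_Mapping.single 0 (inverse k) \<in> subpolys Z"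
        by (intro subpolys_mult q subpolys_single) auto
      ultimately show ?thesis by blast
    qed
    then show "{h. Poly_Mapping.keys h \<subseteq> cone c Z} \<subseteq> (\<lambda>p. p * ?w) ` subpolys Z" by blast
  qed
  ultimately show ?thesis by (metis (no_types, lifting) image_cong image_image stanley_span_cl)
qed

lemma finsum_singleton_M:
  assumes "f x \<in> carrier M"
  shows "(\<Oplus>\<^bsub>M\<^esub>b\<in>{x}. f b) = f x"
proof -
  interpret abelian_monoid M by (rule abelian_monoid_M)
  show ?thesis using assms by simp
qed

text \<open>The generator alone is a basis. A multiple of \<open>x_pow c\<close> by an element of
  \<open>K[Z]\<close> is supported in the cone, hence in \<open>mons\<close>, so it vanishes modulo
  \<open>J\<close> only if it is zero, and then the monomial cancels.\<close>

lemma stanley_space_x_pow: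
  assumes c: "cone c Z \<subseteq> mons"
  shows "stanley_space M (cl (x_pow c)) Z"
proof -
  interpret abelian_monoid M by (rule abelian_monoid_M)
  let ?u = "cl (x_pow c)"
  have cA: "c \<in> upset A" using c apex_in_cone[of c Z] by (auto simp: mons_def)
  have cI: "x_pow c \<in> I" using cA by (simp add: x_pow_mem_I)
  have "x_pow c \<in> mpoly_component (\<lambda>i. int (c i))" by (simp add: mpoly_component_def)
  then have hom: "homogeneous M ?u" unfolding homogeneous_def component_M using cI by blast
  note span = stanley_span_cl[OF cI, of Z]
  have single: "(\<Oplus>\<^bsub>M\<^esub>b\<in>{?u}. f b \<odot>\<^bsub>M\<^esub> b) = cl (f ?u * x_pow c)" for f
    using finsum_singleton_M[of "\<lambda>b. f b \<odot>\<^bsub>M\<^esub> b" ?u] cI by (simp add: smult_M carrier_M I_closed)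
  have indep: "p = 0" if p: "p \<in> subpolys Z" "cl (p * x_pow c) = cl 0" for p
  proof -
    have "Poly_Mapping.keys (p * x_pow c) \<subseteq> mons"
    proof
      fix v assume "v \<in> Poly_Mapping.keys (p * x_pow c)"
      then obtain u where "u \<in> Poly_Mapping.keys p" "v = u + c"
        using keys_mult[of p "x_pow c"] by auto
      then have "v \<in> cone c Z" using p by (auto simp: subpolys_def cone_def le_fun_def)
      then show "v \<in> mons" using c by blast
    qed
    then have 0: "p * x_pow c = 0" using cl_inject[OF p(2)] by simp
    show "p = 0"
    proof (rule poly_mapping_eqI)
      fix v
      have "c \<le> v + c" by (simp add: le_fun_def)
      then show "Poly_Mapping.lookup p v = Poly_Mapping.lookup 0 v"
        using lookup_times_x_pow[of p c "v + c"] by (simp add: 0)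
    qed
  qed
  have "subpoly_basis M Z (stanley_span M ?u Z) {?u}"
    unfolding subpoly_basis_def
  proof (intro conjI ballI allI impI)
    have "1 \<in> subpolys Z" by (simp add: subpolys_def)
    then show "{?u} \<subseteq> stanley_span M ?u Z" unfolding span by (auto intro: image_eqI[of _ _ 1])
  next
    fix x assume "x \<in> stanley_span M ?u Z"
    then obtain p where "p \<in> subpolys Z" "x = cl (p * x_pow c)" unfolding span by auto
    then show "\<exists>F f. finite F \<and> F \<subseteq> {?u} \<and> f \<in> F \<rightarrow> subpolys Z \<and> x = (\<Oplus>\<^bsub>M\<^esub>b\<in>F. f b \<odot>\<^bsub>M\<^esub> b)"
      by (intro exI[of _ "{?u}"] exI[of _ "\<lambda>_. p"]) (simp add: single del: finsum_insert)
  next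
    fix F f b
    assume Ff: "finite F \<and> F \<subseteq> {?u} \<and> f \<in> F \<rightarrow> subpolys Z \<and> (\<Oplus>\<^bsub>M\<^esub>b\<in>F. f b \<odot>\<^bsub>M\<^esub> b) = \<zero>\<^bsub>M\<^esub>"
      and b: "b \<in> F"
    then have "F = {?u}" "b = ?u" by auto
    then show "f b = 0" using Ff indep[of "f ?u"] single[of f] by (simp add: zero_M del: finsum_insert)
  qed
  then show ?thesis unfolding stanley_space_def using hom cI by (auto simp: carrier_M)
qed

text \<open>A nonzero Stanley space is torsion-free, so multiplication by \<open>K[Z]\<close> cannot lead from its
  generator into \<open>J\<close>.\<close>

lemma stanley_space_cone:
  assumes st: "stanley_space M u Z" and u: "u \<noteq> \<zero>\<^bsub>M\<^esub>"
  obtains c where "cone c Z \<subseteq> mons"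
    "stanley_span M u Z = cl ` {h. Poly_Mapping.keys h \<subseteq> cone c Z}"
proof -
  interpret abelian_monoid M by (rule abelian_monoid_M)
  from st obtain d f where f: "u = cl f" "f \<in> I" "f \<in> mpoly_component d"
    unfolding stanley_space_def homogeneous_def component_M by blast
  have "f \<noteq> 0" using u f by (auto simp: zero_M)
  then obtain c where c: "c \<in> Poly_Mapping.keys f" by (metis poly_mapping_eq_sum_single sum.empty ex_in_conv)
  \<comment> \<open>The degree of a homogeneous polynomial determines its exponents, so a nonzero
    one consists of a single term.\<close>
  have "v = c" if "v \<in> Poly_Mapping.keys f" for v
    using that c f(3) by (auto simp: mpoly_component_def fun_eq_iff) (metis of_nat_eq_iff)
  then have keys: "Poly_Mapping.keys f = {c}" using c by blast
  define k where "k = Poly_Mapping.lookup f c"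
  have fc: "f = Poly_Mapping.single c k"
    using poly_mapping_eq_sum_single[of f] by (simp add: keys k_def)
  have k: "k \<noteq> 0" using c by (simp add: in_keys_iff k_def)
  have cA: "c \<in> upset A" using f(2) keys by (simp add: mem_I)
  from st obtain E where E: "subpoly_basis M Z (stanley_span M u Z) E"
    unfolding stanley_space_def by blast
  note span = stanley_span_cl[OF f(2), of Z]
  have "v \<notin> upset B" if v: "v \<in> cone c Z" for v
  proof
    assume vB: "v \<in> upset B"
    have "1 \<in> subpolys Z" by (simp add: subpolys_def)
    then have "u \<in> stanley_span M u Z" unfolding f(1) span by (auto intro: image_eqI[of _ _ 1])
    from subpoly_basisD(2)[OF E this]
    obtain F h where F: "F \<subseteq> E" "u = (\<Oplus>\<^bsub>M\<^esub>b\<in>F. h b \<odot>\<^bsub>M\<^esub> b)"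
      by (elim exE conjE)
    \<comment> \<open>Since \<open>u\<close> is nonzero, its expansion is nonempty, which supplies a
      basis element \<open>b\<close>.\<close>
    have "F \<noteq> {}"
    proof
      assume "F = {}"
      then have "u = \<zero>\<^bsub>M\<^esub>" using F(2) by (simp only: finsum_empty)
      then show False using u by contradiction
    qed
    then obtain b where b: "b \<in> E" using F(1) by fast
    then have "b \<in> stanley_span M u Z" using subpoly_basisD(1)[OF E] by fast
    then obtain p where p: "p \<in> subpolys Z" "b = cl (p * f)" unfolding f(1) span by auto
    have vc: "v - c + c = v" using v by (auto simp: cone_def le_fun_def fun_eq_iff)
    let ?x = "x_pow (v - c) :: ('n, 'k) mpoly"
    \<comment> \<open>The monomial \<open>?x\<close> moves the generator to the exponent
      \<open>v\<close>, hence into \<open>J\<close>. It therefore annihilates the whole Stanley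
      space, including \<open>b\<close>, against the independence of \<open>b\<close> over
      \<open>K[Z]\<close>.\<close>
    have "?x * f = Poly_Mapping.single v k" by (simp add: fc mult_single vc)
    then have "?x * f \<in> J" using vB by (simp add: mem_J)
    then have "p * (?x * f) \<in> J" by (rule J_closed)
    then have "?x * (p * f) \<in> J" by (simp add: mult_ac)
    then have "?x \<odot>\<^bsub>M\<^esub> b = \<zero>\<^bsub>M\<^esub>" by (simp add: p smult_M zero_M cl_eq_iff)
    then have "(\<Oplus>\<^bsub>M\<^esub>b\<in>{b}. ?x \<odot>\<^bsub>M\<^esub> b) = \<zero>\<^bsub>M\<^esub>"
      using finsum_singleton_M[of "\<lambda>b. ?x \<odot>\<^bsub>M\<^esub> b" b] zero_closed by simp
    moreover have "?x \<in> subpolys Z"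
      using v by (auto simp: cone_def intro!: subpolys_single)
    ultimately have "?x = 0"
      using subpoly_basisD(3)[OF E, of "{b}" "\<lambda>_. ?x" b] b by (simp del: finsum_insert)
    then show False by (metis keys_single keys_zero one_neq_zero insert_not_empty)
  qed
  moreover have "v \<in> upset A" if "v \<in> cone c Z" for v
    using that cA unfolding cone_def upset_def by (auto intro: order_trans)
  ultimately have "cone c Z \<subseteq> mons" by (auto simp: mons_def)
  then show ?thesis using that stanley_span_single[OF cA k, of Z] by (simp add: f(1) fc)
qed

text \<open>Freeness makes every nonzero summand the span of a cone, and directness makes these
  cones disjoint and exhaustive. Zero summands carry no exponents and are left out of the index
  set.\<close>

lemma stanley_decomposition_cones:
  assumes "stanley_decomposition M D"
  obtains c where
    "disjoint_family_on (\<lambda>p. cone (c p) (snd p)) {p \<in> D. fst p \<noteq> \<zero>\<^bsub>M\<^esub>}"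
    "(\<Union>p\<in>{p \<in> D. fst p \<noteq> \<zero>\<^bsub>M\<^esub>}. cone (c p) (snd p)) = mons"
proof -
  let ?D = "{p \<in> D. fst p \<noteq> \<zero>\<^bsub>M\<^esub>}"
  let ?S = "\<lambda>p. stanley_span M (fst p) (snd p)"
  have D: "finite D" "\<And>p. p \<in> D \<Longrightarrow> stanley_space M (fst p) (snd p)"
    and sum: "\<And>x. x \<in> carrier M \<Longrightarrow>
      \<exists>!f. f \<in> (\<Pi>\<^sub>E (u, Z)\<in>D. stanley_span M u Z) \<and> x = (\<Oplus>\<^bsub>M\<^esub>p\<in>D. f p)"
    using assms unfolding stanley_decomposition_def by auto
  have "\<forall>p\<in>?D. \<exists>c. cone c (snd p) \<subseteq> mons \<and> ?S p = cl ` {h. Poly_Mapping.keys h \<subseteq> cone c (snd p)}"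
  proof
    fix p assume p: "p \<in> ?D"
    then have "stanley_space M (fst p) (snd p)" "fst p \<noteq> \<zero>\<^bsub>M\<^esub>" using D by auto
    then obtain c where "cone c (snd p) \<subseteq> mons"
      "?S p = cl ` {h. Poly_Mapping.keys h \<subseteq> cone c (snd p)}"
      by (rule stanley_space_cone)
    then show "\<exists>c. cone c (snd p) \<subseteq> mons \<and> ?S p = cl ` {h. Poly_Mapping.keys h \<subseteq> cone c (snd p)}"
      by blast
  qed
  from bchoice[OF this] obtain c where c: "\<forall>p\<in>?D. cone (c p) (snd p) \<subseteq> mons
      \<and> ?S p = cl ` {h. Poly_Mapping.keys h \<subseteq> cone (c p) (snd p)}"
    by (rule exE)
  \<comment> \<open>Zero summands receive the empty set of exponents, which spans the zero space;
    the criterion for direct sums then applies to all of \<open>D\<close>.\<close>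
  define T where "T p = (if p \<in> ?D then cone (c p) (snd p) else {})" for p
  have T_empty: "T p = {}" if "p \<notin> ?D" for p
    using that unfolding T_def by (rule if_not_P)
  have T: "T p \<subseteq> mons" for p
  proof (cases "p \<in> ?D")
    case True
    then show ?thesis using bspec[OF c True] by (simp add: T_def)
  next
    case False
    then show ?thesis using T_empty[OF False] by simp
  qed
  have span: "?S p = cl ` {h. Poly_Mapping.keys h \<subseteq> T p}" if p: "p \<in> D" for p
  proof (cases "p \<in> ?D")
    case True
    then show ?thesis using bspec[OF c True] by (simp add: T_def)
  next
    case False
    then have "fst p = cl 0" using p by (simp add: zero_M)
    then have "?S p = {cl 0}"
      by (simp add: stanley_span_cl[OF I_closed(1)] image_constant[OF subpolys_zero])
    then show ?thesis using T_empty[OF False] by simp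
  qed
  have "(\<Pi>\<^sub>E (u, Z)\<in>D. stanley_span M u Z) = (\<Pi>\<^sub>E p\<in>D. cl ` {h. Poly_Mapping.keys h \<subseteq> T p})"
    using span by (intro PiE_cong) (simp add: case_prod_beta)
  note parts = direct_sum_imp_partition[OF D(1) T sum[unfolded this]]
  have "disjoint_family_on T ?D" using parts(1) by (auto simp: disjoint_family_on_def)
  then have "disjoint_family_on (\<lambda>p. cone (c p) (snd p)) ?D"
    unfolding disjoint_family_on_def by (simp add: T_def)
  moreover have "(\<Union>p\<in>D. T p) = (\<Union>p\<in>?D. cone (c p) (snd p))"
    by (auto simp: T_def split: if_splits)
  ultimately show ?thesis using that parts(2) by simp
qed

section \<open>From interval partitions to Stanley decompositions\<close>

lemma mem_partition_decomposition:
  assumes "interval_partition (char_poset A B g) Q"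
  shows "p \<in> partition_decomposition J (char_poset A B g) g Q \<longleftrightarrow>
    (\<exists>(a, d)\<in>Q. \<exists>c\<in>piece g a d. p = (cl (x_pow c), max_vars g d))"
proof -
  have "interval_in (char_poset A B g) a d = {a..d}" if "(a, d) \<in> Q" for a d
    using assms that by (intro mem_interval_char_poset) (auto simp: interval_partition_def)
  then show ?thesis
    by (fastforce simp: partition_decomposition_def piece_def cl_def)
qed

text \<open>All cones of an interval with upper end \<open>d\<close> have dimension
  \<open>rho g d\<close>, and there is at least one, with the lower end as apex.\<close>

lemma sdepth_partition_decomposition:
  assumes Q: "interval_partition (char_poset A B g) Q"
  shows "sdepth_decomposition (partition_decomposition J (char_poset A B g) g Q) =
    Min ((\<lambda>(c, d). rho g d) ` Q)"
proof -
  have "a \<in> piece g a d" if "(a, d) \<in> Q" for a d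
    using Q that by (auto simp: interval_partition_def piece_def)
  then have "(\<lambda>(u, Z). card Z) ` partition_decomposition J (char_poset A B g) g Q =
      (\<lambda>(c, d). rho g d) ` Q"
    by (force simp: image_iff mem_partition_decomposition[OF Q] rho_def)
  then show ?thesis by (simp add: sdepth_decomposition_def)
qed

context
  fixes g :: "'n \<Rightarrow> nat"
  assumes A_le: "\<forall>a\<in>A. a \<le> g" and B_le: "\<forall>b\<in>B. b \<le> g"
begin

text \<open>All generators lie below \<open>g\<close>, so cutting at \<open>g\<close> changes
  neither membership in \<open>upset A\<close> nor in \<open>upset B\<close>. Cutting thus retracts
  the exponents in \<open>mons\<close> onto the finite poset.\<close>

lemma inf_mem_char_poset: "inf m g \<in> char_poset A B g \<longleftrightarrow> m \<in> mons"
  by (simp add: mem_char_poset mons_def inf_upset[OF A_le] inf_upset[OF B_le])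

text \<open>The cones attached to an interval partition the set of those \<open>m\<close> for which
  \<open>inf m g\<close> lies in it. As the intervals partition the poset, all cones together
  partition \<open>mons\<close>.\<close>

lemma stanley_decomposition_partition:
  assumes Q: "interval_partition (char_poset A B g) Q"
  shows "stanley_decomposition M (partition_decomposition J (char_poset A B g) g Q)"
proof -
  let ?P = "char_poset A B g"
  let ?D = "partition_decomposition J ?P g Q"
  note mem_D = mem_partition_decomposition[OF Q]
  have ends: "a \<in> ?P" "d \<in> ?P" "a \<le> d" "d \<le> g" if "(a, d) \<in> Q" for a d
    using Q that by (auto simp: interval_partition_def mem_char_poset)
  have int: "interval_in ?P a d = {a..d}" if "(a, d) \<in> Q" for a d
    using ends[OF that] by (intro mem_interval_char_poset)
  have "?P = (\<Union>(a, d)\<in>Q. interval_in ?P a d)"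
    using Q unfolding interval_partition_def by blast
  also have "\<dots> = (\<Union>(a, d)\<in>Q. {a..d})" using int by (intro SUP_cong) auto
  finally have cover: "?P = (\<Union>(a, d)\<in>Q. {a..d})" .
  have disj: "(a, d) = (a', d')" if "(a, d) \<in> Q" "(a', d') \<in> Q" "v \<in> {a..d}" "v \<in> {a'..d'}"
    for a d a' d' v
  proof (rule ccontr)
    assume "(a, d) \<noteq> (a', d')"
    then have "interval_in ?P a d \<inter> interval_in ?P a' d' = {}"
      using Q that(1,2) unfolding interval_partition_def by fast
    then show False using int that by auto
  qed
  have inf: "inf m g \<in> {a..d}" if "(a, d) \<in> Q" "c \<in> piece g a d" "m \<in> cone c (max_vars g d)"
    for a d c m
    using cone_piece(1,2)[OF ends(4)[OF that(1)] that(2,3)] by simp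
  have cone_mons: "cone c (max_vars g d) \<subseteq> mons" if "(a, d) \<in> Q" "c \<in> piece g a d" for a d c
  proof
    fix m assume "m \<in> cone c (max_vars g d)"
    from inf[OF that this] that(1) have "inf m g \<in> ?P" unfolding cover by blast
    then show "m \<in> mons" by (simp add: inf_mem_char_poset)
  qed
  have apex_mons: "c \<in> mons" if "(a, d) \<in> Q" "c \<in> piece g a d" for a d c
    using cone_mons[OF that] apex_in_cone by blast
  \<comment> \<open>Summands are recorded as residue classes; this map recovers the exponent, as
    distinct monomials in \<open>mons\<close> have distinct classes.\<close>
  define apex where "apex = the_inv_into mons (\<lambda>c. cl (x_pow c))"
  have inj: "inj_on (\<lambda>c. cl (x_pow c)) mons"
  proof (rule inj_onI)
    fix c c' assume "c \<in> mons" "c' \<in> mons" "cl (x_pow c) = cl (x_pow c')"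
    then have "x_pow c = (x_pow c' :: ('n, 'k) mpoly)" by (intro cl_inject) auto
    then have "Poly_Mapping.keys (x_pow c :: ('n, 'k) mpoly) = Poly_Mapping.keys (x_pow c' :: ('n, 'k) mpoly)"
      by simp
    then show "c = c'" by simp
  qed
  have apex: "apex (cl (x_pow c)) = c" if "c \<in> mons" for c
    unfolding apex_def using the_inv_into_f_f[OF inj that] .
  define T where "T p = cone (apex (fst p)) (snd p)" for p
  have D_cases: "\<exists>a d c. (a, d) \<in> Q \<and> c \<in> piece g a d \<and> p = (cl (x_pow c), max_vars g d)
      \<and> T p = cone c (max_vars g d)" if p: "p \<in> ?D" for p
  proof -
    from p obtain a d c where *: "(a, d) \<in> Q" "c \<in> piece g a d" "p = (cl (x_pow c), max_vars g d)"
      unfolding mem_D by blast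
    have "T p = cone c (max_vars g d)" using apex[OF apex_mons[OF *(1,2)]] by (simp add: T_def *(3))
    then show ?thesis using * by blast
  qed
  have finite: "finite ?D"
  proof (rule finite_subset)
    \<comment> \<open>Each summand is determined by its apex and the upper end of its interval, both
      points of the finite poset.\<close>
    show "?D \<subseteq> (\<lambda>(c, d). (cl (x_pow c), max_vars g d)) ` (?P \<times> ?P)"
    proof
      fix p assume "p \<in> ?D"
      then obtain a d c where *: "(a, d) \<in> Q" "c \<in> piece g a d" "p = (cl (x_pow c), max_vars g d)"
        unfolding mem_D by blast
      have "c \<le> d" using *(2) by (simp add: piece_def)
      then have "c \<in> ?P"
        using order_trans[of c d g] apex_mons[OF *(1,2)] ends(4)[OF *(1)] by (simp add: mem_char_poset mons_def)
      then show "p \<in> (\<lambda>(c, d). (cl (x_pow c), max_vars g d)) ` (?P \<times> ?P)"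
        using * ends(2) by (auto intro!: image_eqI[of _ _ "(c, d)"])
    qed
  qed (simp add: finite_char_poset)
  have spaces: "stanley_space M u Z" if "(u, Z) \<in> ?D" for u Z
    using that cone_mons stanley_space_x_pow unfolding mem_D by blast
  have sum: "\<exists>!f. f \<in> (\<Pi>\<^sub>E (u, Z)\<in>?D. stanley_span M u Z) \<and> x = (\<Oplus>\<^bsub>M\<^esub>p\<in>?D. f p)"
    if x: "x \<in> carrier M" for x
  proof -
    have "(case p of (u, Z) \<Rightarrow> stanley_span M u Z) = cl ` {h. Poly_Mapping.keys h \<subseteq> T p}"
      if "p \<in> ?D" for p
    proof -
      from D_cases[OF that] obtain a d c where *: "(a, d) \<in> Q" "c \<in> piece g a d"
        "p = (cl (x_pow c), max_vars g d)" "T p = cone c (max_vars g d)" by blast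
      have "c \<in> upset A" using apex_mons[OF *(1,2)] by (simp add: mons_def)
      then show ?thesis unfolding *(4) using stanley_span_single[of c 1] by (simp add: *(3))
    qed
    then have eq: "(\<Pi>\<^sub>E (u, Z)\<in>?D. stanley_span M u Z) =
        (\<Pi>\<^sub>E p\<in>?D. cl ` {h. Poly_Mapping.keys h \<subseteq> T p})"
      by (rule PiE_cong)
    have "disjoint_family_on T ?D"
      unfolding disjoint_family_on_def
    proof (intro ballI impI equals0I)
      fix p q m assume pq: "p \<in> ?D" "q \<in> ?D" "p \<noteq> q" "m \<in> T p \<inter> T q"
      from D_cases[OF pq(1)] obtain a d c where 1: "(a, d) \<in> Q" "c \<in> piece g a d"
        "p = (cl (x_pow c), max_vars g d)" "T p = cone c (max_vars g d)" by blast
      from D_cases[OF pq(2)] obtain a' d' c' where 2: "(a', d') \<in> Q" "c' \<in> piece g a' d'"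
        "q = (cl (x_pow c'), max_vars g d')" "T q = cone c' (max_vars g d')" by blast
      have m: "m \<in> cone c (max_vars g d)" "m \<in> cone c' (max_vars g d')"
        using pq(4) 1(4) 2(4) by auto
      \<comment> \<open>The point \<open>inf m g\<close> lies in both intervals, so they coincide;
        within one interval, \<open>m\<close> determines the apex.\<close>
      from disj[OF 1(1) 2(1) inf[OF 1(1,2) m(1)] inf[OF 2(1,2) m(2)]]
      have ad: "a = a'" "d = d'" by auto
      have "c = c'"
        using cone_piece(3)[OF ends(4)[OF 1(1)] 1(2) m(1)]
          cone_piece(3)[OF ends(4)[OF 2(1)] 2(2) m(2)] by (simp only: ad)
      then show False using pq(3) 1(3) 2(3) ad by simp
    qed
    moreover have "(\<Union>p\<in>?D. T p) = mons"
    proof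
      show "(\<Union>p\<in>?D. T p) \<subseteq> mons"
      proof
        fix m assume "m \<in> (\<Union>p\<in>?D. T p)"
        then obtain p where "p \<in> ?D" "m \<in> T p" by blast
        with D_cases[OF this(1)] show "m \<in> mons" using cone_mons by blast
      qed
      show "mons \<subseteq> (\<Union>p\<in>?D. T p)"
      proof
        fix m assume "m \<in> mons"
        then have "inf m g \<in> ?P" by (simp add: inf_mem_char_poset)
        then obtain a d where ad: "(a, d) \<in> Q" "a \<le> inf m g" "inf m g \<le> d" unfolding cover by auto
        from ex_cone_piece[OF ends(4)[OF ad(1)] ad(2,3)]
        obtain c where c: "c \<in> piece g a d" "m \<in> cone c (max_vars g d)" by blast
        let ?p = "(cl (x_pow c), max_vars g d)"
        have "?p \<in> ?D" unfolding mem_D using ad(1) c(1) by blast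
        moreover have "m \<in> T ?p" using c(2) apex[OF apex_mons[OF ad(1) c(1)]] by (simp add: T_def)
        ultimately show "m \<in> (\<Union>p\<in>?D. T p)" by blast
      qed
    qed
    ultimately show ?thesis unfolding eq by (rule partition_imp_direct_sum[OF finite _ _ x])
  qed
  show ?thesis
    unfolding stanley_decomposition_def
  proof (intro conjI ballI)
    show "case p of (u, Z) \<Rightarrow> stanley_space M u Z" if "p \<in> ?D" for p
      using spaces that by (cases p) simp
  qed (simp_all only: finite sum)
qed

section \<open>From Stanley decompositions to interval partitions\<close>

text \<open>A polynomial in \<open>I\<close> but not in \<open>J\<close> has an exponent in
  \<open>mons\<close>, which is then cut at \<open>g\<close>. Consequently every partition has an
  interval, and the minimum of its \<open>rho\<close> values is meaningful.\<close>

lemma char_poset_nonempty: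
  assumes "J \<noteq> I"
  shows "char_poset A B g \<noteq> {}"
proof -
  obtain f where "f \<in> I" "f \<notin> J" using assms J_subset_I by blast
  then obtain v where "v \<in> mons" by (auto simp: mem_I mem_J mons_def)
  then show ?thesis using inf_mem_char_poset by blast
qed

text \<open>The partition comes from intersecting the cones of \<open>D\<close> with the box; each
  of its upper ends dominates the dimension of some summand. Zero summands yield no interval but
  still count on the left, where they can only lower the minimum.\<close>

lemma stanley_decomposition_le_partition:
  assumes D: "stanley_decomposition M D" and ne: "J \<noteq> I"
  obtains Q where "interval_partition (char_poset A B g) Q"
    "sdepth_decomposition D \<le> Min ((\<lambda>(c, d). rho g d) ` Q)"
proof -
  let ?D = "{p \<in> D. fst p \<noteq> \<zero>\<^bsub>M\<^esub>}"
  have fin: "finite D" using D by (simp add: stanley_decomposition_def)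
  obtain c where c: "disjoint_family_on (\<lambda>p. cone (c p) (snd p)) ?D"
    "(\<Union>p\<in>?D. cone (c p) (snd p)) = upset A - upset B"
    using stanley_decomposition_cones[OF D] unfolding mons_def by blast
  define Q where "Q = (\<lambda>p. (c p, \<lambda>j. if j \<in> snd p then g j else c p j)) ` {p \<in> ?D. c p \<le> g}"
  have "finite ?D" using fin by simp
  note Q = cones_interval_partition[OF this c Q_def]
  have "Q \<noteq> {}" using Q(1) char_poset_nonempty[OF ne] by (auto simp: interval_partition_def)
  moreover have "finite Q" using Q(1) by (simp add: interval_partition_def)
  moreover have "sdepth_decomposition D \<le> rho g d" if ad: "(a, d) \<in> Q" for a d
  proof -
    from Q(2)[OF ad] obtain p where p: "p \<in> D" "card (snd p) \<le> rho g d" by blast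
    have "sdepth_decomposition D \<le> card (snd p)"
      unfolding sdepth_decomposition_def using fin p(1) by (intro Min_le) (auto simp: case_prod_beta)
    then show ?thesis using p(2) by simp
  qed
  ultimately have "sdepth_decomposition D \<le> Min ((\<lambda>(c, d). rho g d) ` Q)"
    by (subst Min_ge_iff) auto
  then show ?thesis using that Q(1) by blast
qed

end

end

theorem corollary2p5:
  fixes A B :: "('n::finite \<Rightarrow> nat) set"
    and g :: "'n \<Rightarrow> nat"
    and I J :: "('n, 'k::field) mpoly set"
  assumes "finite A" and "finite B"
    and "I = monomial_ideal A" and "J = monomial_ideal B"
    and "J \<subset> I"
    and "\<forall>a \<in> A. a \<le> g" and "\<forall>b \<in> B. b \<le> g"
  shows "sdepth (quotient_module I J) =
           Max {sdepth_decomposition (partition_decomposition J (char_poset A B g) g Q) | Q.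
                  interval_partition (char_poset A B g) Q}
       \<and> (\<exists>Q. interval_partition (char_poset A B g) Q
              \<and> sdepth (quotient_module I J) = Min ((\<lambda>(c, d). rho g d) ` Q))"
proof -
  interpret monomial_quotient A B I J
    using assms by unfold_locales auto
  let ?P = "char_poset A B g"
  let ?rho = "\<lambda>Q. Min ((\<lambda>(c, d). rho g d) ` Q)"
  define S where "S = {sdepth_decomposition D | D. stanley_decomposition M D}"
  define S' where
    "S' = {sdepth_decomposition (partition_decomposition J ?P g Q) | Q. interval_partition ?P Q}"
  have ne: "J \<noteq> I" using assms(5) by blast
  have S': "S' = {?rho Q | Q. interval_partition ?P Q}"
    unfolding S'_def using sdepth_partition_decomposition by metis
  have sub: "S' \<subseteq> S"
    unfolding S_def S'_def using stanley_decomposition_partition[OF assms(6,7)] by blast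
  \<comment> \<open>The number of variables bounds all values, so \<open>S'\<close> is finite and
    its \<open>Max\<close> is attained.\<close>
  have "?rho Q \<le> card (UNIV :: 'n set)" if Q: "interval_partition ?P Q" for Q
  proof -
    have "finite Q" "Q \<noteq> {}"
      using Q char_poset_nonempty[OF assms(6,7) ne] by (auto simp: interval_partition_def)
    then obtain a d where "(a, d) \<in> Q" by fastforce
    then have "?rho Q \<le> rho g d" using \<open>finite Q\<close> by (intro Min_le) auto
    also have "\<dots> \<le> card (UNIV :: 'n set)" unfolding rho_def by (rule card_mono) auto
    finally show ?thesis .
  qed
  then have "S' \<subseteq> {..card (UNIV :: 'n set)}" unfolding S' by blast
  then have fin: "finite S'" by (rule finite_subset) simp
  have "interval_partition ?P ((\<lambda>c. (c, c)) ` ?P)"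
    by (intro interval_partition_singletons finite_char_poset)
  then have "S' \<noteq> {}" unfolding S'_def by auto
  then have max: "Max S' \<in> S'" using fin by (rule Max_in[rotated])
  have le: "s \<le> Max S'" if "s \<in> S" for s
  proof -
    from that obtain D where D: "stanley_decomposition M D" "s = sdepth_decomposition D"
      unfolding S_def by blast
    obtain Q where "interval_partition ?P Q" "s \<le> ?rho Q"
      using stanley_decomposition_le_partition[OF assms(6,7) D(1) ne] unfolding D(2) by metis
    moreover from this have "?rho Q \<le> Max S'" using fin S' by (intro Max_ge) auto
    ultimately show ?thesis by simp
  qed
  \<comment> \<open>The bound by \<open>Max S'\<close> also gives the finiteness of
    \<open>S\<close>, on which the meaning of \<open>Max S\<close> depends.\<close>
  then have "finite S" by (intro finite_subset[of S "{..Max S'}"]) auto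
  then have "Max S = Max S'" using le sub max by (intro Max_eqI) auto
  then have "sdepth M = Max S'" by (simp add: sdepth_def S_def)
  moreover have "\<exists>Q. interval_partition ?P Q \<and> Max S' = ?rho Q" using max unfolding S' by blast
  ultimately show ?thesis unfolding S'_def by simp
qed

end
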